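(* Let $n\ge 1$, $n\ne 3$, let $\mathcal X$ be a $GC_n$ set and let $\ell$ be an $n$-node line of $\mathcal X$. Suppose that there are $n$ maximal lines of $\mathcal X$ passing through $n$ distinct nodes in $\ell$ (that is, writing $\ell\cap\mathcal X=\{A_1,\dots,A_n\}$, there are distinct maximal lines $M_1,\dots,M_n$ with $A_i\in M_i$ for each $i$). Then there is at least one more maximal line in $\mathcal X$.
   Context: $\Pi_n$ denotes the space of real bivariate polynomials of total degree at most $n$; $\dim\Pi_n=\binom{n+2}{2}$. A finite set $\mathcal X$ of distinct points (nodes) in the plane is $n$-poised if for arbitrary prescribed values at the nodes there is a unique $p\in\Pi_n$ taking these values; then $|\mathcal X|=\binom{n+2}{2}$. For an $n$-poised set $\mathcal X$ and $A\in\mathcal X$, the ($n$-)fundamental polynomial $p_A^\star\in\Pi_n$ is the one equal to $1$ at $A$ and $0$ at all other nodes. An $n$-poised set is a $GC_n$ set if the fundamental polynomial of each of its nodes is a product of $n$ linear factors (polynomials of degree one). A $k$-node line is a line passing through exactly $k$ nodes of $\mathcal X$; a maximal line of an $n$-poised (in particular $GC_n$) set is an $(n+1)$-node line. *)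

theory Defs
  imports "HOL-Analysis.Analysis"
begin

text \<open>
  Bivariate real polynomials are represented by the functions on the plane they induce; since the
  real field is infinite, this identification is faithful.
\<close>

definition Poly2 :: "nat \<Rightarrow> (real \<times> real \<Rightarrow> real) set" where
  "Poly2 n = {p. \<exists>c :: nat \<Rightarrow> nat \<Rightarrow> real.
      \<forall>x y. p (x, y) = (\<Sum>i\<le>n. \<Sum>j\<le>n - i. c i j * x ^ i * y ^ j)}"

definition poised :: "nat \<Rightarrow> (real \<times> real) set \<Rightarrow> bool" where
  "poised n X \<longleftrightarrow> finite X \<and>
     (\<forall>f :: real \<times> real \<Rightarrow> real. \<exists>!p. p \<in> Poly2 n \<and> (\<forall>A\<in>X. p A = f A))"

text \<open>Meaningful only for \<^term>\<open>poised n X\<close> and \<^term>\<open>A \<in> X\<close>.\<close>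

definition fund_poly :: "nat \<Rightarrow> (real \<times> real) set \<Rightarrow> real \<times> real \<Rightarrow> (real \<times> real \<Rightarrow> real)" where
  "fund_poly n X A = (THE p. p \<in> Poly2 n \<and> p A = 1 \<and> (\<forall>B\<in>X - {A}. p B = 0))"

definition linear_poly :: "(real \<times> real \<Rightarrow> real) \<Rightarrow> bool" where
  "linear_poly l \<longleftrightarrow> l \<in> Poly2 1 \<and> l \<notin> Poly2 0"

definition GC :: "nat \<Rightarrow> (real \<times> real) set \<Rightarrow> bool" where
  "GC n X \<longleftrightarrow> poised n X \<and>
     (\<forall>A\<in>X. \<exists>l :: nat \<Rightarrow> real \<times> real \<Rightarrow> real.
        (\<forall>i\<in>{1..n}. linear_poly (l i)) \<and> fund_poly n X A = (\<lambda>P. \<Prod>i=1..n. l i P))"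

definition is_line :: "(real \<times> real) set \<Rightarrow> bool" where
  "is_line L \<longleftrightarrow> affine L \<and> aff_dim L = 1"

definition node_line :: "nat \<Rightarrow> (real \<times> real) set \<Rightarrow> (real \<times> real) set \<Rightarrow> bool" where
  "node_line k X L \<longleftrightarrow> is_line L \<and> card (L \<inter> X) = k"

definition maximal_line :: "nat \<Rightarrow> (real \<times> real) set \<Rightarrow> (real \<times> real) set \<Rightarrow> bool" where
  "maximal_line n X L \<longleftrightarrow> node_line (n + 1) X L"

end

theory Submission
  imports Defs
begin

text \<open>
  In a \<open>GC\<^sub>n\<close> set the nodes other than \<open>A\<close> are covered by \<open>n\<close> lines avoiding \<open>A\<close>. A maximal line
  avoiding \<open>A\<close> carries \<open>n + 1\<close> nodes, so it must be one of these lines. Consequently two maximal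
  lines meet in a node and no three are concurrent at a node. Hence each \<open>M\<^sub>i\<close> carries, besides
  \<open>A\<^sub>i\<close> and its intersections with the other \<open>M\<^sub>j\<close>, a further node \<open>C\<^sub>i\<close>; and some node \<open>B\<close> lies on no
  \<open>M\<^sub>i\<close>, as otherwise the product of the equations of the \<open>M\<^sub>i\<close> would vanish at all nodes.

  Among the \<open>n\<close> lines for the node \<open>M\<^sub>i \<inter> M\<^sub>j\<close> are all \<open>M\<^sub>k\<close> with \<open>k \<noteq> i, j\<close>, so the other two
  cover \<open>A\<^sub>i, A\<^sub>j, C\<^sub>i, C\<^sub>j, B\<close>. Therefore \<open>B\<close> is collinear with \<open>C\<^sub>i, C\<^sub>j\<close>, or with \<open>A\<^sub>i, C\<^sub>j\<close>, or with
  \<open>A\<^sub>j, C\<^sub>i\<close>. Since a line through \<open>B\<close> contains at most one \<open>A\<^sub>i\<close>, unless \<open>n = 3\<close> a single line through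
  \<open>B\<close> contains \<open>A\<^sub>i\<close> or \<open>C\<^sub>i\<close> for every \<open>i\<close>.
\<close>

section \<open>Lines in the plane\<close>

lemma is_line_hyperplane:
  "is_line N \<longleftrightarrow> (\<exists>a b. a \<noteq> 0 \<and> N = {P. a \<bullet> P = b})"
proof
  assume "is_line N"
  then have N: "aff_dim N = int (DIM(real \<times> real) - 1)" "affine hull N = N"
    by (auto simp: is_line_def hull_same)
  then show "\<exists>a b. a \<noteq> 0 \<and> N = {P. a \<bullet> P = b}"
    using aff_dim_eq_hyperplane[THEN iffD1, OF N(1)] unfolding N(2) by simp
next
  assume "\<exists>a b. a \<noteq> 0 \<and> N = {P. a \<bullet> P = b}"
  then show "is_line N"
    by (auto simp: is_line_def affine_hyperplane aff_dim_hyperplane)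
qed

lemma is_line_affine_hull:
  assumes "P \<noteq> Q"
  shows "is_line (affine hull {P, Q})"
  using assms by (simp add: is_line_def aff_dim_2)

lemma is_line_eq_affine_hull:
  assumes "is_line N" "P \<in> N" "Q \<in> N" "P \<noteq> Q"
  shows "N = affine hull {P, Q}"
proof -
  have "affine hull {P, Q} \<subseteq> N"
    using assms by (intro hull_minimal) (auto simp: is_line_def)
  moreover have "aff_dim (affine hull {P, Q}) = aff_dim N"
    using assms by (simp add: is_line_def aff_dim_2)
  ultimately show ?thesis
    using affine_dim_equal[of "affine hull {P, Q}" N] assms(1) by (simp add: is_line_def)
qed

lemma is_line_unique:
  assumes "is_line N" "is_line N'" "P \<noteq> Q" "P \<in> N" "Q \<in> N" "P \<in> N'" "Q \<in> N'"
  shows "N = N'"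
  using assms is_line_eq_affine_hull by metis

text \<open>Every line of \<open>S\<close> differs from \<open>N\<close>, so it meets
  \<open>N\<close> in at most one point; assigning to each point of \<open>T\<close> a line of
  \<open>S\<close> through it is therefore injective. All later counting of nodes on a line rests on
  this bound.\<close>

lemma card_covered_by_lines_le:
  assumes "finite S" "\<And>K. K \<in> S \<Longrightarrow> is_line K" "is_line N" "N \<notin> S" "T \<subseteq> N" "T \<subseteq> \<Union>S"
  shows "card T \<le> card S"
proof -
  have "\<forall>P\<in>T. \<exists>K. K \<in> S \<and> P \<in> K"
    using assms(6) by blast
  from bchoice[OF this] obtain f where "\<forall>P\<in>T. f P \<in> S \<and> P \<in> f P" ..
  then have f: "\<And>P. P \<in> T \<Longrightarrow> f P \<in> S \<and> P \<in> f P"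
    by simp
  have "inj_on f T"
  proof (rule inj_onI, rule ccontr)
    fix P Q assume PQ: "P \<in> T" "Q \<in> T" "f P = f Q" "P \<noteq> Q"
    then have "N = f P"
      using f[OF PQ(1)] f[OF PQ(2)] assms(2)[of "f P"] assms(3,5)
      by (intro is_line_unique[of N "f P" P Q]) auto
    then show False
      using f[of P] PQ(1) assms(4) by simp
  qed
  then show ?thesis
    using card_inj_on_le[of f T S] f assms(1) by blast
qed

section \<open>Linear factors and closure properties of \<open>Poly2\<close>\<close>

lemma linear_polyE:
  assumes "linear_poly l"
  obtains a b where "a \<noteq> 0" "l = (\<lambda>P. a \<bullet> P - b)"
proof -
  from assms obtain c :: "nat \<Rightarrow> nat \<Rightarrow> real" where
    c: "\<And>x y. l (x, y) = (\<Sum>i\<le>1. \<Sum>j\<le>1 - i. c i j * x ^ i * y ^ j)"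
    unfolding linear_poly_def Poly2_def by blast
  have l: "l (x, y) = c 0 0 + c 1 0 * x + c 0 1 * y" for x y
    using c[of x y] by simp
  have "(c 1 0, c 0 1) \<noteq> 0"
  proof
    assume "(c 1 0, c 0 1) = 0"
    then have "l \<in> Poly2 0"
      using l by (auto simp: Poly2_def zero_prod_def intro!: exI[of _ c])
    with assms show False
      by (simp add: linear_poly_def)
  qed
  moreover have "l = (\<lambda>P. (c 1 0, c 0 1) \<bullet> P - (- c 0 0))"
    using l by auto
  ultimately show thesis
    using that by blast
qed

lemma linear_poly_zero_line:
  assumes "linear_poly l"
  shows "is_line {P. l P = 0}"
  using assms by (elim linear_polyE) (auto simp: is_line_hyperplane)

lemma Poly2_add:
  assumes "p \<in> Poly2 n" "q \<in> Poly2 n"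
  shows "(\<lambda>P. p P + q P) \<in> Poly2 n"
proof -
  from assms obtain c d :: "nat \<Rightarrow> nat \<Rightarrow> real" where
    "\<And>x y. p (x, y) = (\<Sum>i\<le>n. \<Sum>j\<le>n - i. c i j * x ^ i * y ^ j)"
    "\<And>x y. q (x, y) = (\<Sum>i\<le>n. \<Sum>j\<le>n - i. d i j * x ^ i * y ^ j)"
    unfolding Poly2_def by blast
  then show ?thesis
    unfolding Poly2_def
    by (auto intro!: exI[of _ "\<lambda>i j. c i j + d i j"] simp: sum.distrib algebra_simps)
qed

lemma Poly2_scale:
  assumes "p \<in> Poly2 n"
  shows "(\<lambda>P. r * p P) \<in> Poly2 n"
proof -
  from assms obtain c :: "nat \<Rightarrow> nat \<Rightarrow> real" where
    "\<And>x y. p (x, y) = (\<Sum>i\<le>n. \<Sum>j\<le>n - i. c i j * x ^ i * y ^ j)"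
    unfolding Poly2_def by blast
  then show ?thesis
    unfolding Poly2_def
    by (auto intro!: exI[of _ "\<lambda>i j. r * c i j"] simp: sum_distrib_left algebra_simps)
qed

lemma Poly2_Suc:
  assumes "p \<in> Poly2 n"
  shows "p \<in> Poly2 (Suc n)"
proof -
  from assms obtain c :: "nat \<Rightarrow> nat \<Rightarrow> real" where
    c: "\<And>x y. p (x, y) = (\<Sum>i\<le>n. \<Sum>j\<le>n - i. c i j * x ^ i * y ^ j)"
    unfolding Poly2_def by blast
  \<comment> \<open>The values of \<open>c\<close> beyond total degree \<open>n\<close> are
    arbitrary; they are cut to 0 so that the larger summation range adds no terms.\<close>
  define d where "d i j = (if i + j \<le> n then c i j else 0)" for i j
  have "p (x, y) = (\<Sum>i\<le>Suc n. \<Sum>j\<le>Suc n - i. d i j * x ^ i * y ^ j)" for x y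
    by (auto simp: c d_def Suc_diff_le intro!: sum.cong)
  then show ?thesis
    unfolding Poly2_def by blast
qed

lemma Poly2_times_fst:
  assumes "p \<in> Poly2 n"
  shows "(\<lambda>P. fst P * p P) \<in> Poly2 (Suc n)"
proof -
  from assms obtain c :: "nat \<Rightarrow> nat \<Rightarrow> real" where
    c: "\<And>x y. p (x, y) = (\<Sum>i\<le>n. \<Sum>j\<le>n - i. c i j * x ^ i * y ^ j)"
    unfolding Poly2_def by blast
  define d where "d i j = (case i of 0 \<Rightarrow> 0 | Suc i \<Rightarrow> c i j)" for i j
  have "x * p (x, y) = (\<Sum>i\<le>Suc n. \<Sum>j\<le>Suc n - i. d i j * x ^ i * y ^ j)" for x y
    by (subst sum.atMost_Suc_shift) (simp add: c d_def sum_distrib_left algebra_simps)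
  then show ?thesis
    unfolding Poly2_def by (auto intro!: exI[of _ d])
qed

lemma Poly2_times_snd:
  assumes "p \<in> Poly2 n"
  shows "(\<lambda>P. snd P * p P) \<in> Poly2 (Suc n)"
proof -
  from assms obtain c :: "nat \<Rightarrow> nat \<Rightarrow> real" where
    c: "\<And>x y. p (x, y) = (\<Sum>i\<le>n. \<Sum>j\<le>n - i. c i j * x ^ i * y ^ j)"
    unfolding Poly2_def by blast
  define d where "d i j = (case j of 0 \<Rightarrow> 0 | Suc j \<Rightarrow> c i j)" for i j
  \<comment> \<open>The index shift is stated for \<open>i \<le> n\<close>; in the remaining row
    \<open>i = Suc n\<close> the only index is \<open>j = 0\<close>, where \<open>d\<close> is
    0.\<close>
  have "(\<Sum>j\<le>Suc n - i. d i j * x ^ i * y ^ j) = (\<Sum>j\<le>n - i. c i j * x ^ i * y ^ Suc j)"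
    if "i \<le> n" for i x y
    using that by (simp only: Suc_diff_le sum.atMost_Suc_shift) (simp add: d_def)
  then have "y * p (x, y) = (\<Sum>i\<le>Suc n. \<Sum>j\<le>Suc n - i. d i j * x ^ i * y ^ j)" for x y
    by (simp add: c d_def sum_distrib_left algebra_simps)
  then show ?thesis
    unfolding Poly2_def by (auto intro!: exI[of _ d])
qed

lemma Poly2_times_affine:
  assumes "p \<in> Poly2 n"
  shows "(\<lambda>P. (a \<bullet> P - b) * p P) \<in> Poly2 (Suc n)"
proof -
  have "(\<lambda>P. (fst a * (fst P * p P) + snd a * (snd P * p P)) + (- b) * p P) \<in> Poly2 (Suc n)"
    by (intro Poly2_add Poly2_scale Poly2_times_fst Poly2_times_snd Poly2_Suc assms)
  then show ?thesis
    by (simp add: inner_prod_def algebra_simps)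
qed

lemma Poly2_prod_affine:
  assumes "finite I"
  shows "(\<lambda>P. \<Prod>i\<in>I. a i \<bullet> P - b i) \<in> Poly2 (card I)"
  using assms
proof induction
  case empty
  show ?case
    by (auto simp: Poly2_def intro!: exI[of _ "\<lambda>_ _. 1"])
next
  case (insert i I)
  then show ?case
    using Poly2_times_affine[OF insert.IH] by simp
qed

section \<open>Coverings of the nodes by lines\<close>

lemma poised_not_covered:
  assumes X: "poised n X" and M: "\<And>i. i \<in> {1..n} \<Longrightarrow> is_line (M i)"
  obtains B where "B \<in> X" "\<And>i. i \<in> {1..n} \<Longrightarrow> B \<notin> M i"
proof -
  from M have "\<forall>i\<in>{1..n}. \<exists>a b. a \<noteq> 0 \<and> M i = {P. a \<bullet> P = b}"
    by (simp add: is_line_hyperplane)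
  then obtain a b where ab: "\<And>i. i \<in> {1..n} \<Longrightarrow> a i \<noteq> 0 \<and> M i = {P. a i \<bullet> P = b i}"
    by metis
  define p where "p P = (\<Prod>i\<in>{1..n}. a i \<bullet> P - b i)" for P
  have p: "p \<in> Poly2 n"
    using Poly2_prod_affine[of "{1..n}" a b] by (simp add: p_def[abs_def])
  have zero: "(\<lambda>_. 0) \<in> Poly2 n"
    using Poly2_scale[OF p, of 0] by simp
  have p_eq_0: "p P = 0 \<longleftrightarrow> (\<exists>i\<in>{1..n}. P \<in> M i)" for P
    using ab by (auto simp: p_def)
  \<comment> \<open>Finitely many lines form a null set, so they cannot fill the plane.\<close>
  have "\<exists>P. p P \<noteq> 0"
  proof (rule ccontr)
    assume "\<nexists>P. p P \<noteq> 0"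
    then have "(\<Union>i\<in>{1..n}. M i) = UNIV"
      using p_eq_0 by blast
    moreover have "negligible (\<Union>i\<in>{1..n}. M i)"
      using ab by (intro negligible_Union) (auto intro!: negligible_hyperplane)
    ultimately show False
      by (metis non_negligible_UNIV)
  qed
  moreover have "\<exists>!q. q \<in> Poly2 n \<and> (\<forall>P\<in>X. q P = 0)"
    using X unfolding poised_def by (elim conjE) (erule allE)
  then have "p = (\<lambda>_. 0)" if "\<And>P. P \<in> X \<Longrightarrow> p P = 0"
    using p zero that by blast
  ultimately obtain B where "B \<in> X" "p B \<noteq> 0"
    by fastforce
  then show thesis
    using that p_eq_0 by blast
qed

text \<open>The lines are the zero sets of the factors of the fundamental polynomial, whose value 1
  at \<open>A\<close> keeps them away from \<open>A\<close>. Distinct factors may share a zero line,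
  hence only \<open>card S \<le> n\<close>.\<close>

lemma GC_cover:
  assumes "GC n X" "A \<in> X"
  obtains S where "finite S" "card S \<le> n" "\<And>K. K \<in> S \<Longrightarrow> is_line K" "A \<notin> \<Union>S" "X - {A} \<subseteq> \<Union>S"
proof -
  from assms obtain l :: "nat \<Rightarrow> real \<times> real \<Rightarrow> real" where
    l: "\<And>i. i \<in> {1..n} \<Longrightarrow> linear_poly (l i)" and
    fund: "fund_poly n X A = (\<lambda>P. \<Prod>i=1..n. l i P)"
    unfolding GC_def by blast
  \<comment> \<open>Interpolating the indicator of \<open>A\<close> shows that the description in
    \<open>fund_poly\<close> determines exactly one polynomial, which justifies
    \<open>theI'\<close>.\<close>
  have "\<exists>!p. p \<in> Poly2 n \<and> (\<forall>B\<in>X. p B = (if B = A then 1 else 0))"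
    using assms(1) unfolding GC_def poised_def by (elim conjE) (erule allE)
  moreover have "p A = 1 \<and> (\<forall>B\<in>X - {A}. p B = 0) \<longleftrightarrow> (\<forall>B\<in>X. p B = (if B = A then 1 else 0))"
    for p :: "real \<times> real \<Rightarrow> real"
    using assms(2) by auto
  ultimately have "\<exists>!p. p \<in> Poly2 n \<and> p A = 1 \<and> (\<forall>B\<in>X - {A}. p B = 0)"
    by simp
  from theI'[OF this] have *: "fund_poly n X A A = 1" "\<And>B. B \<in> X - {A} \<Longrightarrow> fund_poly n X A B = 0"
    unfolding fund_poly_def by blast+
  define S where "S = (\<lambda>i. {P. l i P = 0}) ` {1..n}"
  show thesis
  proof
    show "finite S" "card S \<le> n"
      using card_image_le[of "{1..n}"] by (auto simp: S_def)
    show "is_line K" if "K \<in> S" for K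
      using that l by (auto simp: S_def linear_poly_zero_line)
    show "A \<notin> \<Union>S"
    proof
      assume "A \<in> \<Union>S"
      then have "(\<Prod>i=1..n. l i A) = 0"
        by (auto simp: S_def)
      with *(1) fund show False
        by simp
    qed
    show "X - {A} \<subseteq> \<Union>S"
    proof
      fix B assume "B \<in> X - {A}"
      with *(2) fund have "(\<Prod>i=1..n. l i B) = 0"
        by simp
      then show "B \<in> \<Union>S"
        by (auto simp: S_def)
    qed
  qed
qed

section \<open>Maximal lines of a GC set\<close>

lemma GC_finite: "GC n X \<Longrightarrow> finite X"
  by (simp add: GC_def poised_def)

lemma GC_line_card_le:
  assumes "GC n X" "is_line N"
  shows "card (N \<inter> X) \<le> n + 1"
\<comment> \<open>For a node \<open>A\<close> on \<open>N\<close>, the covering lines avoid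
  \<open>A\<close> and so differ from \<open>N\<close>; each covers at most one of the other nodes
  of \<open>N\<close>.\<close>
proof (cases "N \<inter> X = {}")
  case False
  then obtain A where A: "A \<in> N" "A \<in> X"
    by blast
  obtain S where S: "finite S" "card S \<le> n" "\<And>K. K \<in> S \<Longrightarrow> is_line K" "A \<notin> \<Union>S" "X - {A} \<subseteq> \<Union>S"
    using GC_cover[OF assms(1) A(2)] by metis
  have "card (N \<inter> X - {A}) \<le> card S"
    using S A assms by (intro card_covered_by_lines_le[of S N]) auto
  then show ?thesis
    using S(2) by (simp add: card_Diff_singleton_if A split: if_splits)
qed simp

lemma maximal_line_in_cover:
  assumes "maximal_line n X N" "A \<notin> N"
    and "finite S" "card S \<le> n" "\<And>K. K \<in> S \<Longrightarrow> is_line K" "X - {A} \<subseteq> \<Union>S"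
  shows "N \<in> S"
proof (rule ccontr)
  assume "N \<notin> S"
  then have "card (N \<inter> X) \<le> card S"
    using assms by (intro card_covered_by_lines_le[of S N]) (auto simp: maximal_line_def node_line_def)
  then show False
    using assms by (simp add: maximal_line_def node_line_def)
qed

text \<open>Without a common node, the cover for a node \<open>A\<close> of \<open>N'\<close>
  contains \<open>N\<close>, which covers no node of \<open>N'\<close>. At most \<open>n - 1\<close>
  lines remain for the other \<open>n\<close> nodes of \<open>N'\<close>.\<close>

lemma maximal_lines_meet:
  assumes GC: "GC n X" and N: "maximal_line n X N" "maximal_line n X N'"
  shows "N \<inter> N' \<inter> X \<noteq> {}"
proof
  assume disj: "N \<inter> N' \<inter> X = {}"
  have N': "is_line N'" "card (N' \<inter> X) = n + 1"
    using N by (auto simp: maximal_line_def node_line_def)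
  then have "N' \<inter> X \<noteq> {}"
    by force
  then obtain A where A: "A \<in> N'" "A \<in> X"
    by blast
  obtain S where S: "finite S" "card S \<le> n" "\<And>K. K \<in> S \<Longrightarrow> is_line K" "A \<notin> \<Union>S" "X - {A} \<subseteq> \<Union>S"
    using GC_cover[OF GC A(2)] by metis
  have NS: "N \<in> S"
    using maximal_line_in_cover[OF N(1) _ S(1,2,3,5)] A disj by blast
  have "N' \<inter> X - {A} \<subseteq> \<Union>(S - {N})"
  proof
    fix Q assume Q: "Q \<in> N' \<inter> X - {A}"
    then have "Q \<notin> N"
      using disj by auto
    then show "Q \<in> \<Union>(S - {N})"
      using S(5) Q by blast
  qed
  then have "card (N' \<inter> X - {A}) \<le> card (S - {N})"
    using S(1,3,4) A(1) N'(1) by (intro card_covered_by_lines_le[of "S - {N}" N']) auto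
  then have "n \<le> card S - 1"
    using N' A NS S(1) by simp
  moreover have "card S > 0"
    using NS S(1) by (auto simp: card_gt_0_iff)
  ultimately show False
    using S(2) by linarith
qed

text \<open>If \<open>P\<close> were on \<open>M3\<close>, the cover for another node
  \<open>A\<close> of \<open>M3\<close> would contain \<open>M1\<close> and \<open>M2\<close>, both
  meeting \<open>M3\<close> only in \<open>P\<close>. At most \<open>n - 2\<close> lines would
  remain for \<open>n - 1\<close> nodes.\<close>

lemma maximal_lines_not_concurrent:
  assumes GC: "GC n X" and "n \<ge> 1"
    and M: "maximal_line n X M1" "maximal_line n X M2" "maximal_line n X M3"
    and ne: "M1 \<noteq> M2" "M1 \<noteq> M3" "M2 \<noteq> M3"
    and P: "P \<in> X" "P \<in> M1" "P \<in> M2"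
  shows "P \<notin> M3"
proof
  assume P3: "P \<in> M3"
  have lines: "is_line M1" "is_line M2" "is_line M3" and card: "card (M3 \<inter> X) = n + 1"
    using M by (auto simp: maximal_line_def node_line_def)
  have "card (M3 \<inter> X - {P}) = n"
    using card P P3 by simp
  then have "M3 \<inter> X - {P} \<noteq> {}"
    using \<open>n \<ge> 1\<close> by (intro notI) simp
  then obtain A where A: "A \<in> M3" "A \<in> X" "A \<noteq> P"
    by blast
  have only: "Q = P" if "Q \<in> M3" "Q \<in> M1 \<or> Q \<in> M2" for Q
    using that P P3 lines ne is_line_unique by metis
  obtain S where S: "finite S" "card S \<le> n" "\<And>K. K \<in> S \<Longrightarrow> is_line K" "A \<notin> \<Union>S" "X - {A} \<subseteq> \<Union>S"
    using GC_cover[OF GC A(2)] by metis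
  have MS: "M1 \<in> S" "M2 \<in> S"
    using maximal_line_in_cover[OF _ _ S(1,2,3,5)] M A only by blast+
  have "M3 \<inter> X - {P, A} \<subseteq> \<Union>(S - {M1, M2})"
  proof
    fix Q assume Q: "Q \<in> M3 \<inter> X - {P, A}"
    then have "Q \<notin> M1" "Q \<notin> M2"
      using only[of Q] by auto
    then show "Q \<in> \<Union>(S - {M1, M2})"
      using S(5) Q by blast
  qed
  then have "card (M3 \<inter> X - {P, A}) \<le> card (S - {M1, M2})"
    using S(1,3,4) A(1) lines(3) by (intro card_covered_by_lines_le[of "S - {M1, M2}" M3]) auto
  moreover have "card (M3 \<inter> X - {P, A}) = n - 1"
    using card P P3 A by (subst card_Diff_subset) auto
  moreover have "card (S - {M1, M2}) = card S - 2"
    using MS ne S(1) by (subst card_Diff_subset) auto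
  \<comment> \<open>This makes the subtraction in \<open>card S - 2\<close> a genuine one.\<close>
  moreover have "card {M1, M2} \<le> card S"
    using MS S(1) by (intro card_mono) auto
  ultimately show False
    using S(2) ne by simp
qed

text \<open>The excluded nodes on \<open>M i\<close> are \<open>A\<close> and at most one
  intersection with each of the other \<open>n - 1\<close> lines, fewer than \<open>n + 1\<close> in
  total.\<close>

lemma maximal_line_further_node:
  assumes GC: "GC n X"
    and M: "\<And>i. i \<in> {1..n} \<Longrightarrow> maximal_line n X (M i)" and inj: "inj_on M {1..n}"
    and i: "i \<in> {1..n}"
  obtains C where "C \<in> X" "C \<in> M i" "C \<noteq> A" "\<And>j. j \<in> {1..n} - {i} \<Longrightarrow> C \<notin> M j"
proof -
  let ?T = "insert A (\<Union>j\<in>{1..n} - {i}. M i \<inter> M j \<inter> X)"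
  have lines: "is_line (M j)" if "j \<in> {1..n}" for j
    using M[OF that] by (simp add: maximal_line_def node_line_def)
  have fin: "finite ?T"
    using GC_finite[OF GC] by auto
  have le1: "card (M i \<inter> M j \<inter> X) \<le> 1" if j: "j \<in> {1..n} - {i}" for j
  proof -
    have "M i \<noteq> M j"
      using j i inj by (auto dest: inj_onD)
    then have "P = Q" if "P \<in> M i \<inter> M j \<inter> X" "Q \<in> M i \<inter> M j \<inter> X" for P Q
      using that is_line_unique[of "M i" "M j" P Q] lines i j by blast
    then show ?thesis
      using GC_finite[OF GC] by (simp add: card_le_Suc0_iff_eq)
  qed
  have "card (\<Union>j\<in>{1..n} - {i}. M i \<inter> M j \<inter> X) \<le> (\<Sum>j\<in>{1..n} - {i}. card (M i \<inter> M j \<inter> X))"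
    by (intro card_UN_le) simp
  also have "\<dots> \<le> (\<Sum>j\<in>{1..n} - {i}. 1)"
    by (intro sum_mono le1)
  also have "\<dots> = n - 1"
    using i by simp
  finally have "card ?T \<le> Suc (n - 1)"
    using card_insert_le_m1 fin by (simp add: card_insert_if)
  also have "\<dots> < card (M i \<inter> X)"
    using M[OF i] i by (simp add: maximal_line_def node_line_def)
  finally have "\<not> M i \<inter> X \<subseteq> ?T"
    using card_mono[OF fin] by (meson not_le)
  then show thesis
    using that by blast
qed

section \<open>Singling out one line through \<open>B\<close>\<close>

text \<open>For \<open>n = 3\<close> the cyclic pattern \<open>R 1 2\<close>, \<open>R 2 3\<close>, \<open>R 3 1\<close> is a counterexample.\<close>

lemma single_out_line:
  fixes D :: "nat \<Rightarrow> 'a" and R :: "nat \<Rightarrow> nat \<Rightarrow> bool"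
  assumes n: "n \<ge> 1" "n \<noteq> 3"
    and pair: "\<And>i j. i \<in> {1..n} \<Longrightarrow> j \<in> {1..n} \<Longrightarrow> i \<noteq> j \<Longrightarrow> D i = D j \<or> R i j \<or> R j i"
    and uniq: "\<And>k i j. k \<in> {1..n} \<Longrightarrow> i \<in> {1..n} \<Longrightarrow> j \<in> {1..n} \<Longrightarrow> R k i \<Longrightarrow> R k j \<Longrightarrow> i = j"
    and cong: "\<And>k k' i. D k = D k' \<Longrightarrow> R k i = R k' i"
  shows "\<exists>k\<in>{1..n}. \<forall>i\<in>{1..n}. D i = D k \<or> R k i"
proof (cases "inj_on D {1..n}")
  case False
  then obtain k m where km: "k \<in> {1..n}" "m \<in> {1..n}" "k \<noteq> m" "D k = D m"
    by (auto simp: inj_on_def)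
  \<comment> \<open>If this fails, comparing \<open>i\<close> with both \<open>k\<close> and
    \<open>m\<close> forces \<open>R i k\<close> and \<open>R i m\<close>, contrary to
    uniqueness.\<close>
  have "D i = D k \<or> R k i" if "i \<in> {1..n}" for i
    using pair[of i k] pair[of i m] uniq[of i k m] cong[of k m i] km that by metis
  then show ?thesis
    using km by blast
next
  case True
  then have *: "R i j \<or> R j i" if "i \<in> {1..n}" "j \<in> {1..n}" "i \<noteq> j" for i j
    using pair[OF that] that by (auto dest: inj_onD)
  consider "n = 1" | "n = 2" | "n \<ge> 4"
    using n by linarith
  then show ?thesis
  proof cases
    case 1
    then show ?thesis by auto
  next
    case 2
    then have "{1..n} = {1, 2}" by auto
    then show ?thesis
      using *[of 1 2] by auto
  next
    case 3
    then have "1 \<in> {1..n}" "2 \<in> {1..n}" "3 \<in> {1..n}" "4 \<in> {1..n}"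
      by auto
    note mem = this
    have out: "\<not> (R k i \<and> R k j)" if "k \<in> {1..n}" "i \<in> {1..n}" "j \<in> {1..n}" "i \<noteq> j" for k i j
      using uniq that by blast
    \<comment> \<open>Among four indices each of the six pairs needs an arrow, but every index has
      at most one outgoing arrow.\<close>
    have False
      using *[OF mem(1,2)] *[OF mem(1,3)] *[OF mem(1,4)] *[OF mem(2,3)] *[OF mem(2,4)] *[OF mem(3,4)]
        out[OF mem(1,2,3)] out[OF mem(1,2,4)] out[OF mem(1,3,4)]
        out[OF mem(2,1,3)] out[OF mem(2,1,4)] out[OF mem(2,3,4)]
        out[OF mem(3,1,2)] out[OF mem(3,1,4)] out[OF mem(3,2,4)]
        out[OF mem(4,1,2)] out[OF mem(4,1,3)] out[OF mem(4,2,3)]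
      by auto
    then show ?thesis ..
  qed
qed

text \<open>A line of \<open>S\<close> through both \<open>A1\<close> and \<open>C1\<close> would be
  \<open>M1\<close> and contain \<open>P\<close>; likewise for \<open>A2\<close>, \<open>C2\<close>
  and \<open>M2\<close>. So \<open>S\<close> consists of two lines, each separating these pairs. If
  \<open>A1\<close> and \<open>A2\<close> share a line, it is \<open>L\<close> and misses
  \<open>B\<close>, so \<open>B\<close> joins \<open>C1\<close> and \<open>C2\<close>; otherwise the
  lines pair \<open>A1\<close> with \<open>C2\<close> and \<open>A2\<close> with
  \<open>C1\<close>.\<close>

lemma two_lines_through_five:
  assumes "finite S" "card S \<le> 2" and lines: "\<And>K. K \<in> S \<Longrightarrow> is_line K"
    and M: "is_line M1" "is_line M2" "P \<in> M1" "P \<in> M2" "P \<notin> \<Union>S"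
    and on: "A1 \<in> M1" "C1 \<in> M1" "A2 \<in> M2" "C2 \<in> M2" "A1 \<noteq> C1" "A2 \<noteq> C2"
    and cov: "{A1, C1, A2, C2, B} \<subseteq> \<Union>S"
    and L: "is_line L" "A1 \<in> L" "A2 \<in> L" "A1 \<noteq> A2" "B \<notin> L"
  obtains K where "is_line K" "B \<in> K"
    "{C1, C2} \<subseteq> K \<or> {A1, C2} \<subseteq> K \<or> {A2, C1} \<subseteq> K"
proof -
  obtain K1 K2 where K: "K1 \<in> S" "A1 \<in> K1" "K2 \<in> S" "C1 \<in> K2"
    using cov by auto
  have ne1: "\<not> (A1 \<in> K \<and> C1 \<in> K)" if "K \<in> S" for K
    using is_line_unique[OF lines[OF that] M(1) on(5)] on M that by blast
  have ne2: "\<not> (A2 \<in> K \<and> C2 \<in> K)" if "K \<in> S" for K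
    using is_line_unique[OF lines[OF that] M(2) on(6)] on M that by blast
  have "K1 \<noteq> K2"
    using ne1 K by blast
  then have "card {K1, K2} = 2"
    by simp
  then have S: "S = {K1, K2}"
    using card_seteq[of S "{K1, K2}"] K assms(1,2) by auto
  show thesis
  proof (cases "A2 \<in> K1")
    case True
    then have "K1 = L"
      using is_line_unique[OF lines[OF K(1)] L(1,4)] K L by blast
    then have "B \<in> K2" "C2 \<in> K2"
      using L cov S ne2[OF K(1)] True by auto
    then show thesis
      using that[of K2] K lines by blast
  next
    case False
    then have "A2 \<in> K2" "C2 \<in> K1"
      using cov S ne2[OF K(3)] by auto
    then show thesis
      using that[of K1] that[of K2] K lines cov S by auto
  qed
qed

section \<open>Construction of the additional maximal line\<close>

theorem proposition4p2:
  fixes n :: nat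
    and X :: "(real \<times> real) set"
    and L :: "(real \<times> real) set"
    and A :: "nat \<Rightarrow> real \<times> real"
    and M :: "nat \<Rightarrow> (real \<times> real) set"
  assumes "n \<ge> 1" and "n \<noteq> 3"
    and "GC n X"
    and "node_line n X L"
    and "bij_betw A {1..n} (L \<inter> X)"
    and "inj_on M {1..n}"
    and "\<And>i. i \<in> {1..n} \<Longrightarrow> maximal_line n X (M i) \<and> A i \<in> M i"
  shows "\<exists>M'. maximal_line n X M' \<and> M' \<notin> M ` {1..n}"
proof -
  note GC = \<open>GC n X\<close> and inj = \<open>inj_on M {1..n}\<close>
  have maxM: "maximal_line n X (M i)" and AM: "A i \<in> M i" if "i \<in> {1..n}" for i
    using assms(7)[OF that] by auto
  have lineM: "is_line (M i)" and cardM: "card (M i \<inter> X) = n + 1" if "i \<in> {1..n}" for i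
    using maxM[OF that] by (auto simp: maximal_line_def node_line_def)
  have M_ne: "M i \<noteq> M j" if "i \<in> {1..n}" "j \<in> {1..n}" "i \<noteq> j" for i j
    using inj that by (auto dest: inj_onD)
  have lineL: "is_line L" and cardL: "card (L \<inter> X) = n"
    using assms(4) by (auto simp: node_line_def)
  have AL: "A i \<in> L" "A i \<in> X" if "i \<in> {1..n}" for i
    using bij_betwE[OF assms(5)] that by auto
  have A_ne: "A i \<noteq> A j" if "i \<in> {1..n}" "j \<in> {1..n}" "i \<noteq> j" for i j
    using bij_betw_imp_inj_on[OF assms(5)] that by (auto dest: inj_onD)
  have A_notin: "A i \<notin> M j" if "i \<in> {1..n}" "j \<in> {1..n}" "i \<noteq> j" for i j
  proof
    \<comment> \<open>Two common points would identify \<open>M j\<close> with \<open>L\<close>,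
      which has \<open>n\<close> nodes instead of \<open>n + 1\<close>.\<close>
    assume "A i \<in> M j"
    then have "M j = L"
      using is_line_unique[OF lineM[OF that(2)] lineL A_ne[OF that]] AL AM that by blast
    then show False
      using cardM[OF that(2)] cardL by simp
  qed
  have "\<forall>i\<in>{1..n}. \<exists>C. C \<in> X \<and> C \<in> M i \<and> C \<noteq> A i \<and> (\<forall>j\<in>{1..n} - {i}. C \<notin> M j)"
    using maximal_line_further_node[OF GC maxM inj] by metis
  then obtain C where C: "\<And>i. i \<in> {1..n} \<Longrightarrow>
      C i \<in> X \<and> C i \<in> M i \<and> C i \<noteq> A i \<and> (\<forall>j\<in>{1..n} - {i}. C i \<notin> M j)"
    by metis
  obtain B where B: "B \<in> X" "\<And>i. i \<in> {1..n} \<Longrightarrow> B \<notin> M i"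
    using poised_not_covered[of n X M] GC lineM unfolding GC_def by blast
  have BL: "B \<notin> L"
  proof
    assume "B \<in> L"
    then have "B \<in> A ` {1..n}"
      using B(1) bij_betw_imp_surj_on[OF assms(5)] by blast
    then show False
      using B(2) AM by blast
  qed
  define D where "D i = affine hull {B, C i}" for i
  have BC: "B \<noteq> C i" if "i \<in> {1..n}" for i
    using B(2)[OF that] C[OF that] by blast
  have lineD: "is_line (D i)" if "i \<in> {1..n}" for i
    using is_line_affine_hull BC[OF that] by (simp add: D_def)
  have BD: "B \<in> D i" and CD: "C i \<in> D i" for i
    by (simp_all add: D_def hull_inc)
  have D_eq: "K = D i" if "i \<in> {1..n}" "is_line K" "B \<in> K" "C i \<in> K" for K i
    using is_line_eq_affine_hull[OF that(2,3,4) BC[OF that(1)]] by (simp add: D_def)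

  have pair: "D i = D j \<or> A j \<in> D i \<or> A i \<in> D j" if ij: "i \<in> {1..n}" "j \<in> {1..n}" "i \<noteq> j" for i j
  proof -
    obtain P where P: "P \<in> X" "P \<in> M i" "P \<in> M j"
      using maximal_lines_meet[OF GC maxM[OF ij(1)] maxM[OF ij(2)]] by blast
    obtain S where S: "finite S" "card S \<le> n" "\<And>K. K \<in> S \<Longrightarrow> is_line K" "P \<notin> \<Union>S" "X - {P} \<subseteq> \<Union>S"
      using GC_cover[OF GC P(1)] by metis
    define I where "I = {1..n} - {i, j}"
    have P_notin: "P \<notin> M k" if "k \<in> I" for k
      using that ij P maximal_lines_not_concurrent[OF GC assms(1), of "M i" "M j" "M k"] maxM M_ne
      by (auto simp: I_def)
    have IS: "M ` I \<subseteq> S"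
    proof
      fix N assume "N \<in> M ` I"
      then obtain k where k: "k \<in> I" "N = M k"
        by blast
      then have "k \<in> {1..n}"
        by (simp add: I_def)
      then show "N \<in> S"
        using maximal_line_in_cover[OF maxM P_notin[OF k(1)] S(1,2,3,5)] k(2) by blast
    qed
    have "card (M ` I) = card I"
      by (rule card_image, rule inj_on_subset[OF inj]) (simp add: I_def)
    also have "card I = n - 2"
      using ij by (simp add: I_def card_Diff_subset)
    finally have "card (S - M ` I) \<le> 2"
      using S(1,2) IS by (subst card_Diff_subset) (auto intro: finite_subset)
    \<comment> \<open>Each of the five nodes misses \<open>M i\<close> or \<open>M j\<close>, hence
      is not \<open>P\<close>, and lies on no \<open>M k\<close> with \<open>k \<in> I\<close>; only
      the remaining lines can cover it.\<close>
    moreover have "Q \<in> \<Union>(S - M ` I)" if Q: "Q \<in> {A i, C i, A j, C j, B}" for Q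
    proof -
      have "Q \<in> X"
        using Q AL(2) C B(1) ij by auto
      moreover have "Q \<notin> M i \<or> Q \<notin> M j"
        using Q A_notin[OF ij] A_notin[OF ij(2,1)] C[OF ij(1)] C[OF ij(2)] B(2)[OF ij(1)] ij by auto
      then have "Q \<noteq> P"
        using P by blast
      ultimately obtain N where N: "N \<in> S" "Q \<in> N"
        using S(5) by blast
      have "Q \<notin> M k" if k: "k \<in> I" for k
      proof -
        have "k \<in> {1..n}" "i \<noteq> k" "j \<noteq> k"
          using k by (auto simp: I_def)
        then show ?thesis
          using Q A_notin[OF ij(1), of k] A_notin[OF ij(2), of k] C[OF ij(1)] C[OF ij(2)] B(2)[of k]
          by auto
      qed
      then show ?thesis
        using N by blast
    qed
    ultimately have S': "card (S - M ` I) \<le> 2" "{A i, C i, A j, C j, B} \<subseteq> \<Union>(S - M ` I)"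
      by (simp, intro subsetI)
    have S'': "finite (S - M ` I)" "\<And>K. K \<in> S - M ` I \<Longrightarrow> is_line K" "P \<notin> \<Union>(S - M ` I)"
      using S by auto
    have CiCj: "C i \<in> M i" "C j \<in> M j" "A i \<noteq> C i" "A j \<noteq> C j"
      using C ij by metis+
    obtain K where K: "is_line K" "B \<in> K"
      "{C i, C j} \<subseteq> K \<or> {A i, C j} \<subseteq> K \<or> {A j, C i} \<subseteq> K"
      using two_lines_through_five[OF S''(1) S'(1) S''(2) lineM[OF ij(1)] lineM[OF ij(2)] P(2,3) S''(3)
          AM[OF ij(1)] CiCj(1) AM[OF ij(2)] CiCj(2-4) S'(2) lineL AL(1)[OF ij(1)] AL(1)[OF ij(2)]
          A_ne[OF ij] BL]
      by blast
    then show ?thesis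
      using D_eq[OF ij(1) K(1,2)] D_eq[OF ij(2) K(1,2)] by auto
  qed
  have "\<exists>k\<in>{1..n}. \<forall>i\<in>{1..n}. D i = D k \<or> A i \<in> D k"
  \<comment> \<open>Here \<open>R k i\<close> is \<open>A i \<in> D k\<close>. Its uniqueness
    condition holds because two of the \<open>A i\<close> on \<open>D k\<close> would give
    \<open>D k = L\<close>, although \<open>B\<close> is not on \<open>L\<close>.\<close>
  proof (rule single_out_line[OF assms(1,2)])
    show "i = j" if "k \<in> {1..n}" "i \<in> {1..n}" "j \<in> {1..n}" "A i \<in> D k" "A j \<in> D k" for k i j
    proof (rule ccontr)
      assume "i \<noteq> j"
      then have "D k = L"
        using is_line_unique[OF lineD[OF that(1)] lineL A_ne[OF that(2,3)]] AL that by blast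
      then show False
        using BD BL by blast
    qed
  qed (use pair in auto)
  then obtain k where k: "k \<in> {1..n}" "\<And>i. i \<in> {1..n} \<Longrightarrow> C i \<in> D k \<or> A i \<in> D k"
    using CD by metis
  \<comment> \<open>\<open>E i\<close> lies on \<open>M i\<close> and on no other
    \<open>M j\<close>, so these nodes are distinct; together with \<open>B\<close> they give
    \<open>n + 1\<close> nodes on \<open>D k\<close>.\<close>
  define E where "E i = (if C i \<in> D k then C i else A i)" for i
  have E: "E i \<in> D k \<inter> X" "E i \<in> M i" "\<And>j. j \<in> {1..n} \<Longrightarrow> i \<noteq> j \<Longrightarrow> E i \<notin> M j"
    if "i \<in> {1..n}" for i
    using k(2)[OF that] C[OF that] AL[OF that] AM[OF that] A_notin[OF that] by (auto simp: E_def)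
  have "inj_on E {1..n}"
    using E(2,3) by (metis inj_onI)
  moreover have "B \<notin> E ` {1..n}"
    using B(2) E(2) by blast
  ultimately have "n + 1 = card (insert B (E ` {1..n}))"
    by (simp add: card_image)
  also have "\<dots> \<le> card (D k \<inter> X)"
    using E(1) BD B(1) GC_finite[OF GC] by (intro card_mono) auto
  finally have "maximal_line n X (D k)"
    using GC_line_card_le[OF GC lineD[OF k(1)]] lineD[OF k(1)]
    by (simp add: maximal_line_def node_line_def)
  moreover have "D k \<notin> M ` {1..n}"
    using BD B(2) by blast
  ultimately show ?thesis
    by blast
qed

end
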